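(* Let $\mathfrak{g}$ be a finite-dimensional real almost abelian Lie algebra with codimension-one abelian ideal $\mathfrak{u}$, equipped with an inner product $\langle\cdot,\cdot\rangle$, and let $e_0\in\mathfrak{g}$ be a unit vector orthogonal to $\mathfrak{u}$ with dual $1$-form $e^0$. Let $p\geq1$ and let $\omega=e^0\wedge\alpha+\beta$ be a $p$-form on $\mathfrak{g}$ with $\alpha\in\Lambda^{p-1}\mathfrak{u}^*$ and $\beta\in\Lambda^p\mathfrak{u}^*$. Then $\omega$ is conformal Killing on $\mathfrak{g}$ if and only if $e^0\wedge\alpha$ is $*$-Killing and $\beta$ is Killing.
   Context: A real Lie algebra $\mathfrak{g}$ is almost abelian if it has an abelian ideal $\mathfrak{u}$ of codimension one. $\Lambda^k\mathfrak{u}^*$ is regarded as the subspace of $\Lambda^k\mathfrak{g}^*$ of forms $\gamma$ with $e_0\lrcorner\gamma=0$, so $\Lambda^p\mathfrak{g}^*=e^0\wedge\Lambda^{p-1}\mathfrak{u}^*\oplus\Lambda^p\mathfrak{u}^*$. The Levi-Civita connection is given on $\mathfrak{g}$ by $2\langle\nabla_xy,z\rangle=\langle[x,y],z\rangle-\langle[y,z],x\rangle+\langle[z,x],y\rangle$, and on $p$-forms by $(\nabla_x\omega)(x_1,\dots,x_p)=-\sum_i\omega(x_1,\dots,\nabla_xx_i,\dots,x_p)$. The exterior derivative is $d\omega(x_0,\dots,x_p)=\sum_{i<j}(-1)^{i+j}\omega([x_i,x_j],x_0,\dots,\hat{x}_i,\dots,\hat{x}_j,\dots,x_p)$, and the codifferential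 is $d^*\omega=-\sum_i e_i\lrcorner\nabla_{e_i}\omega$ for any orthonormal basis $\{e_i\}$ of $\mathfrak{g}$. For $x\in\mathfrak{g}$, $x^*=\langle x,\cdot\rangle$. Let $n=\dim\mathfrak{g}$. A $p$-form $\omega$ is conformal Killing (CKY) if for all $x\in\mathfrak{g}$ $$\nabla_x\omega=\frac{1}{p+1}\,x\lrcorner d\omega-\frac{1}{n-p+1}\,x^*\wedge d^*\omega.$$ It is Killing (KY) if $\nabla_x\omega=\frac{1}{p+1}x\lrcorner d\omega$ for all $x\in\mathfrak{g}$ (equivalently, conformal Killing with $d^*\omega=0$), and $*$-Killing if it is conformal Killing and $d\omega=0$. *)

theory Defs
  imports "HOL-Analysis.Analysis"
begin

text \<open>A finite-dimensional real inner product space is a type of class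
  \<open>euclidean_space\<close>; a Lie algebra structure on it is given by its bracket.\<close>

definition lie_bracket :: "('a::euclidean_space \<Rightarrow> 'a \<Rightarrow> 'a) \<Rightarrow> bool" where
  "lie_bracket br \<longleftrightarrow> bilinear br \<and> (\<forall>x. br x x = 0) \<and>
     (\<forall>x y z. br x (br y z) + br y (br z x) + br z (br x y) = 0)"

definition lie_ideal :: "('a::euclidean_space \<Rightarrow> 'a \<Rightarrow> 'a) \<Rightarrow> 'a set \<Rightarrow> bool" where
  "lie_ideal br u \<longleftrightarrow> subspace u \<and> (\<forall>x. \<forall>y\<in>u. br x y \<in> u)"

text \<open>A Lie algebra is almost abelian if such a \<open>u\<close> exists.\<close>

definition codim_one_abelian_ideal ::
    "('a::euclidean_space \<Rightarrow> 'a \<Rightarrow> 'a) \<Rightarrow> 'a set \<Rightarrow> bool" where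
  "codim_one_abelian_ideal br u \<longleftrightarrow>
     lie_ideal br u \<and> (\<forall>x\<in>u. \<forall>y\<in>u. br x y = 0) \<and> dim u + 1 = DIM('a)"

text \<open>A \<open>p\<close>-form \<open>\<omega>(x\<^sub>1, \<dots>, x\<^sub>p)\<close> is a function of the argument list. It is set to zero on
  lists of any other length, so that equality of forms is equality of functions; the
  operations below preserve this convention.\<close>

type_synonym 'a form = "'a list \<Rightarrow> real"

definition forms :: "nat \<Rightarrow> 'a::euclidean_space form set" where
  "forms p = {\<omega>.
     (\<forall>xs. length xs \<noteq> p \<longrightarrow> \<omega> xs = 0) \<and>
     (\<forall>xs i. length xs = p \<and> i < p \<longrightarrow> linear (\<lambda>v. \<omega> (xs[i := v]))) \<and>
     (\<forall>xs. \<not> distinct xs \<longrightarrow> \<omega> xs = 0)}"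

definition interior :: "'a::euclidean_space \<Rightarrow> 'a form \<Rightarrow> 'a form" where
  "interior x \<omega> = (\<lambda>xs. \<omega> (x # xs))"

definition flat :: "'a::euclidean_space \<Rightarrow> 'a \<Rightarrow> real" where
  "flat x = (\<lambda>y. x \<bullet> y)"

text \<open>Exterior product \<open>\<xi> \<and> \<eta>\<close> of a one-form \<open>\<xi>\<close> (given as a functional) with a form \<open>\<eta>\<close>, in the
  normalisation without factorials, as for the exterior derivative below:
  \<open>(\<xi> \<and> \<eta>)(x\<^sub>0, \<dots>, x\<^sub>q)\<close> is the sum of \<open>(-1)\<^sup>i \<xi>(x\<^sub>i) \<eta>(x\<^sub>0, \<dots>, x\<^sub>q)\<close> with \<open>x\<^sub>i\<close> omitted in \<open>\<eta>\<close>.\<close>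

definition wedge1 :: "('a::euclidean_space \<Rightarrow> real) \<Rightarrow> 'a form \<Rightarrow> 'a form" where
  "wedge1 \<xi> \<eta> = (\<lambda>xs. \<Sum>i<length xs. (-1) ^ i * \<xi> (xs ! i) * \<eta> (nths xs (- {i})))"

text \<open>Levi-Civita connection on the Lie algebra, characterised by the Koszul formula.\<close>

definition levi_civita ::
    "('a::euclidean_space \<Rightarrow> 'a \<Rightarrow> 'a) \<Rightarrow> 'a \<Rightarrow> 'a \<Rightarrow> 'a" where
  "levi_civita br x y =
     (THE v. \<forall>z. 2 * (v \<bullet> z) = br x y \<bullet> z - br y z \<bullet> x + br z x \<bullet> y)"

lemma levi_civita_koszul:
  fixes br :: "'a::euclidean_space \<Rightarrow> 'a \<Rightarrow> 'a"
  assumes "bilinear br"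
  shows "2 * (levi_civita br x y \<bullet> z) = br x y \<bullet> z - br y z \<bullet> x + br z x \<bullet> y"
proof -
  define f where "f z = br x y \<bullet> z - br y z \<bullet> x + br z x \<bullet> y" for z
  have lin: "linear f"
    by (rule linearI)
      (simp_all add: f_def bilinear_ladd[OF assms] bilinear_radd[OF assms]
        bilinear_lmul[OF assms] bilinear_rmul[OF assms] inner_add_left inner_add_right
        distrib_left right_diff_distrib)
  define v where "v = (\<Sum>b\<in>Basis. (f b / 2) *\<^sub>R b)"
  have v: "2 * (v \<bullet> z) = f z" for z
  proof -
    have "f z = f (\<Sum>b\<in>Basis. (z \<bullet> b) *\<^sub>R b)"
      by (simp add: euclidean_representation)
    also have "\<dots> = (\<Sum>b\<in>Basis. (z \<bullet> b) * f b)"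
      by (simp add: linear_sum[OF lin] linear_cmul[OF lin])
    also have "\<dots> = 2 * (v \<bullet> z)"
      unfolding v_def inner_sum_left sum_distrib_left
      by (rule sum.cong[OF refl]) (simp add: inner_commute[of z])
    finally show ?thesis by (rule sym)
  qed
  have "levi_civita br x y = v"
    unfolding levi_civita_def f_def[symmetric]
  proof (rule the_equality)
    fix w assume "\<forall>z. 2 * (w \<bullet> z) = f z"
    then have "2 * (w \<bullet> z) = 2 * (v \<bullet> z)" for z
      using v[of z] by simp
    then show "w = v"
      by (simp add: euclidean_eq_iff[of w v])
  qed (simp add: v)
  then show ?thesis
    by (simp only: v f_def)
qed

definition nabla ::
    "('a::euclidean_space \<Rightarrow> 'a \<Rightarrow> 'a) \<Rightarrow> 'a \<Rightarrow> 'a form \<Rightarrow> 'a form" where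
  "nabla br x \<omega> = (\<lambda>xs. - (\<Sum>i<length xs. \<omega> (xs[i := levi_civita br x (xs ! i)])))"

definition ext_deriv ::
    "('a::euclidean_space \<Rightarrow> 'a \<Rightarrow> 'a) \<Rightarrow> 'a form \<Rightarrow> 'a form" where
  "ext_deriv br \<omega> = (\<lambda>xs. \<Sum>j<length xs. \<Sum>i<j.
     (-1) ^ (i + j) * \<omega> (br (xs ! i) (xs ! j) # nths xs (- {i, j})))"

text \<open>The value does not depend on the orthonormal basis, here \<open>Basis\<close>.\<close>

definition codiff ::
    "('a::euclidean_space \<Rightarrow> 'a \<Rightarrow> 'a) \<Rightarrow> 'a form \<Rightarrow> 'a form" where
  "codiff br \<omega> = (\<lambda>xs. - (\<Sum>b\<in>Basis. interior b (nabla br b \<omega>) xs))"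

text \<open>In degree \<open>p = n + 1\<close> the coefficient \<open>1 / (n - p + 1)\<close> is zero by convention; there are no
  nonzero forms of degree larger than \<open>n\<close>.\<close>

definition conformal_killing ::
    "('a::euclidean_space \<Rightarrow> 'a \<Rightarrow> 'a) \<Rightarrow> nat \<Rightarrow> 'a form \<Rightarrow> bool" where
  "conformal_killing br p \<omega> \<longleftrightarrow> \<omega> \<in> forms p \<and>
     (\<forall>x xs. nabla br x \<omega> xs =
        1 / (real p + 1) * interior x (ext_deriv br \<omega>) xs
        - 1 / (real DIM('a) - real p + 1) * wedge1 (flat x) (codiff br \<omega>) xs)"

definition killing ::
    "('a::euclidean_space \<Rightarrow> 'a \<Rightarrow> 'a) \<Rightarrow> nat \<Rightarrow> 'a form \<Rightarrow> bool" where
  "killing br p \<omega> \<longleftrightarrow> \<omega> \<in> forms p \<and>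
     (\<forall>x xs. nabla br x \<omega> xs = 1 / (real p + 1) * interior x (ext_deriv br \<omega>) xs)"

definition star_killing ::
    "('a::euclidean_space \<Rightarrow> 'a \<Rightarrow> 'a) \<Rightarrow> nat \<Rightarrow> 'a form \<Rightarrow> bool" where
  "star_killing br p \<omega> \<longleftrightarrow> conformal_killing br p \<omega> \<and> (\<forall>xs. ext_deriv br \<omega> xs = 0)"

text \<open>\<open>\<Lambda>\<^sup>k u\<^sup>*\<close>, where \<open>u\<close> is the orthogonal complement of \<open>e\<^sub>0\<close>, as a subspace of \<open>\<Lambda>\<^sup>k g\<^sup>*\<close>.\<close>

definition horizontal_forms :: "'a::euclidean_space \<Rightarrow> nat \<Rightarrow> 'a form set" where
  "horizontal_forms e0 k = {\<gamma> \<in> forms k. \<forall>xs. interior e0 \<gamma> xs = 0}"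

end

theory Submission
  imports Defs
begin

text \<open>The proof is a parity argument. Let \<open>\<sigma>\<close> be the reflection that sends \<open>e0\<close> to \<open>-e0\<close> and fixes the
  ideal \<open>u\<close>. As \<open>u\<close> is abelian, the bracket is \<open>[x, y] = x\<^sub>0 D y - y\<^sub>0 D x\<close>, where \<open>D\<close> is the adjoint
  action of \<open>e0\<close> and \<open>x\<^sub>0 = \<langle>x, e0\<rangle>\<close>. It takes values in \<open>u\<close> and each of its terms contains one component
  along \<open>e0\<close>, so \<open>[\<sigma> x, \<sigma> y] = - \<sigma> [x, y]\<close> (\<open>bracket_mirror\<close>). Thus \<open>\<sigma>\<close> is an isometric isomorphism
  from the Lie algebra onto the one with the opposite bracket. The operators \<open>\<nabla>\<close>, \<open>d\<close> and \<open>d\<^sup>*\<close>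
  are all of degree one in the bracket, so replacing the bracket by its negative changes the sign of both
  sides of the conformal Killing equation, and pulling back along \<open>\<sigma>\<close> maps solutions to solutions
  (\<open>cky_defect_mirror\<close>). Now \<open>e\<^sup>0 \<and> \<alpha>\<close> is odd under \<open>\<sigma>\<close> and \<open>\<beta>\<close> is even. The equation is
  linear, so \<open>e\<^sup>0 \<and> \<alpha> + \<beta>\<close> solves it if and only if both summands do.

  What is left is that \<open>e\<^sup>0 \<and> \<alpha>\<close> is always closed and \<open>\<beta>\<close> always coclosed. Closedness
  (\<open>ext_deriv_vertical\<close>) follows from \<open>d\<omega> = e\<^sup>0 \<and> (D \<cdot> \<omega>)\<close>: the image of \<open>D\<close> is
  orthogonal to \<open>e0\<close>, hence \<open>D \<cdot> (e\<^sup>0 \<and> \<alpha>) = e\<^sup>0 \<and> (D \<cdot> \<alpha>)\<close>, and \<open>e\<^sup>0 \<and> e\<^sup>0 = 0\<close>.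
  Coclosedness (\<open>codiff_horizontal\<close>) holds because, by the explicit form of the Levi-Civita
  connection, the only terms of \<open>d\<^sup>*\<beta>\<close> in which \<open>\<beta>\<close> is not evaluated on \<open>e0\<close> are contractions of the
  alternating \<open>\<beta>\<close> with the symmetric part of \<open>D\<close>.

  Identities between forms are proved by recursion on the argument list, each operation
  being described by its interaction with the interior product by the first argument.\<close>

section \<open>Forms as functions of argument lists\<close>

text \<open>The definition of forms asks for linearity on lists of the right length only; on all other lists the
  map is zero, so later arguments need not keep track of lengths.\<close>

lemma forms_update_linear:
  assumes "\<omega> \<in> forms p" "i < length xs"
  shows "linear (\<lambda>v. \<omega> (xs[i := v]))"
proof (cases "length xs = p")
  case True
  then show ?thesis using assms by (auto simp: forms_def)
next
  case False
  then have "\<omega> (xs[i := v]) = 0" for v using assms by (auto simp: forms_def)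
  then show ?thesis by (simp add: module_hom_zero linear_iff)
qed

lemma forms_Cons_linear:
  assumes "\<omega> \<in> forms p"
  shows "linear (\<lambda>v. \<omega> (v # xs))"
  using forms_update_linear[OF assms, of 0 "0 # xs"] by simp

text \<open>Truncated subtraction is harmless at \<open>p = 0\<close>, where the interior product is the zero form.\<close>

lemma interior_forms:
  assumes "\<omega> \<in> forms p"
  shows "interior x \<omega> \<in> forms (p - 1)"
proof -
  have "linear (\<lambda>v. \<omega> (x # xs[i := v]))" if "i < length xs" for xs i
    using forms_update_linear[OF assms, of "Suc i" "x # xs"] that by simp
  moreover have "\<omega> (x # xs) = 0" if "length xs \<noteq> p - 1" for xs
    using assms that by (auto simp: forms_def)
  moreover have "\<omega> (x # xs) = 0" if "\<not> distinct xs" for xs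
    using assms that by (auto simp: forms_def)
  ultimately show ?thesis by (auto simp: forms_def interior_def)
qed

text \<open>Polarisation of the vanishing on equal arguments.\<close>

lemma forms_swap:
  assumes "\<omega> \<in> forms p"
  shows "\<omega> (x # y # zs) = - \<omega> (y # x # zs)"
proof -
  have z: "\<omega> (v # v # zs) = 0" for v
    using assms by (auto simp: forms_def)
  have l1: "linear (\<lambda>v. \<omega> (v # w # zs))" for w
    by (rule forms_Cons_linear[OF assms])
  have l2: "linear (\<lambda>w. \<omega> (v # w # zs))" for v
    using forms_Cons_linear[OF interior_forms[OF assms], of v zs] by (simp add: interior_def)
  have "\<omega> ((x + y) # (x + y) # zs)
      = \<omega> (x # x # zs) + \<omega> (x # y # zs) + (\<omega> (y # x # zs) + \<omega> (y # y # zs))"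
    using linear_add[OF l1] linear_add[OF l2] by simp
  then show ?thesis by (simp add: z)
qed

text \<open>The brackets in the exterior derivative stand in front of the remaining arguments, whereas the
  connection acts in place; the sign of the cyclic permutation relates the two conventions.\<close>

lemma forms_move_to_front:
  assumes "\<omega> \<in> forms p" "k < length xs"
  shows "\<omega> (xs[k := v]) = (-1) ^ k * \<omega> (v # nths xs (- {k}))"
  using assms
proof (induction xs arbitrary: \<omega> p k)
  case (Cons x xs)
  show ?case
  proof (cases k)
    case 0
    have "{j. Suc j \<in> - {0}} = (UNIV :: nat set)" by auto
    then show ?thesis by (simp add: 0 nths_Cons nths_all)
  next
    case (Suc m)
    have "{j. Suc j \<in> - {Suc m}} = - {m}" by auto
    then have "nths (x # xs) (- {k}) = x # nths xs (- {m})" by (simp add: Suc nths_Cons)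
    then show ?thesis
      using Cons.IH[OF interior_forms[OF Cons.prems(1), of x], of m] Cons.prems
        forms_swap[OF Cons.prems(1), of v x]
      by (simp add: Suc interior_def)
  qed
qed simp

lemma forms_combine:
  assumes "\<omega> \<in> forms p" "\<eta> \<in> forms p"
  shows "(\<lambda>xs. a * \<omega> xs + b * \<eta> xs) \<in> forms p"
  using assms by (auto simp: forms_def linear_iff algebra_simps)

lemma interior_horizontal:
  assumes "\<gamma> \<in> horizontal_forms e0 k"
  shows "interior x \<gamma> \<in> horizontal_forms e0 (k - 1)"
proof -
  have "interior x \<gamma> \<in> forms (k - 1)"
    using assms interior_forms by (auto simp: horizontal_forms_def)
  moreover have "\<gamma> (x # e0 # zs) = 0" for zs
    using assms forms_swap[of \<gamma> k x e0] by (simp add: horizontal_forms_def interior_def)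
  ultimately show ?thesis by (simp add: horizontal_forms_def interior_def)
qed

section \<open>Exterior multiplication, endomorphisms and the exterior derivative\<close>

lemma wedge1_Nil: "wedge1 \<xi> \<eta> [] = 0"
  by (simp add: wedge1_def)

text \<open>The antiderivation rule of the interior product. Together with the value on the empty list it
  determines the wedge product by recursion.\<close>

lemma wedge1_Cons:
  "wedge1 \<xi> \<eta> (x # xs) = \<xi> x * \<eta> xs - wedge1 \<xi> (interior x \<eta>) xs"
proof -
  have "{j. Suc j \<in> - {0}} = (UNIV :: nat set)" "{j. Suc j \<in> - {Suc m}} = - {m}" for m
    by auto
  then show ?thesis
    by (simp add: wedge1_def nths_Cons nths_all interior_def sum.lessThan_Suc_shift sum_negf
        del: sum.lessThan_Suc)
qed

lemma wedge1_combine: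
  "wedge1 \<xi> (\<lambda>ys. a * \<eta> ys + b * \<theta> ys) xs = a * wedge1 \<xi> \<eta> xs + b * wedge1 \<xi> \<theta> xs"
  by (simp add: wedge1_def sum.distrib sum_distrib_left algebra_simps)

lemma wedge1_zero: "wedge1 \<xi> (\<lambda>ys. 0) xs = 0"
  by (simp add: wedge1_def)

text \<open>By the antiderivation rule applied twice, the two terms with the factor \<open>\<xi> x\<close> cancel.\<close>

lemma wedge1_wedge1: "wedge1 \<xi> (wedge1 \<xi> \<eta>) xs = 0"
proof (induction xs arbitrary: \<eta>)
  case (Cons x xs)
  have "interior x (wedge1 \<xi> \<eta>) = (\<lambda>ys. \<xi> x * \<eta> ys + (-1) * wedge1 \<xi> (interior x \<eta>) ys)"
    by (simp add: interior_def[of x "wedge1 \<xi> \<eta>"] wedge1_Cons)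
  then show ?case
    by (simp only: wedge1_Cons wedge1_combine Cons.IH)
qed (simp add: wedge1_Nil)

text \<open>The derivation action of an endomorphism \<open>B\<close> on forms, dual to its action on vectors. The
  covariant derivative is the case of the connection endomorphism, the Lie derivative along a
  left-invariant field that of an adjoint action.\<close>

definition form_action :: "('a::euclidean_space \<Rightarrow> 'a) \<Rightarrow> 'a form \<Rightarrow> 'a form" where
  "form_action B \<omega> = (\<lambda>xs. - (\<Sum>i<length xs. \<omega> (xs[i := B (xs ! i)])))"

lemma form_action_Nil: "form_action B \<omega> [] = 0"
  by (simp add: form_action_def)

lemma form_action_Cons:
  "form_action B \<omega> (x # xs) = form_action B (interior x \<omega>) xs - \<omega> (B x # xs)"
  by (simp add: form_action_def interior_def sum.lessThan_Suc_shift del: sum.lessThan_Suc)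

lemma form_action_combine:
  "form_action B (\<lambda>ys. a * \<eta> ys + b * \<theta> ys) xs = a * form_action B \<eta> xs + b * form_action B \<theta> xs"
  by (simp add: form_action_def sum.distrib sum_distrib_left algebra_simps)

text \<open>The product rule; the term in which \<open>B\<close> acts on \<open>\<xi>\<close> is absent because \<open>\<xi>\<close> kills its image.\<close>

lemma form_action_wedge1:
  assumes "\<And>x. \<xi> (B x) = 0"
  shows "form_action B (wedge1 \<xi> \<eta>) xs = wedge1 \<xi> (form_action B \<eta>) xs"
proof (induction xs arbitrary: \<eta>)
  case (Cons x xs)
  have *: "interior x (wedge1 \<xi> \<eta>) = (\<lambda>ys. \<xi> x * \<eta> ys + (-1) * wedge1 \<xi> (interior x \<eta>) ys)"
    by (simp add: interior_def[of x "wedge1 \<xi> \<eta>"] wedge1_Cons)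
  have **: "interior x (form_action B \<eta>)
      = (\<lambda>ys. 1 * form_action B (interior x \<eta>) ys + (-1) * interior (B x) \<eta> ys)"
    by (simp add: interior_def[of x "form_action B \<eta>"] interior_def[of "B x"] form_action_Cons)
  show ?case
    by (simp only: form_action_Cons wedge1_Cons * ** form_action_combine wedge1_combine Cons.IH
        assms)
qed (simp add: wedge1_Nil form_action_Nil)

lemma ext_deriv_Nil: "ext_deriv br \<omega> [] = 0"
  by (simp add: ext_deriv_def)

text \<open>Cartan's formula \<open>i\<^sub>x d = L\<^sub>x - d i\<^sub>x\<close>: the sum is the part of \<open>d\<omega>\<close> whose brackets involve the first
  argument \<open>x\<close>. In the other terms \<open>x\<close> stands behind the bracket, and the swap with it produces the
  minus sign.\<close>

lemma ext_deriv_Cons: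
  assumes "\<omega> \<in> forms p"
  shows "ext_deriv br \<omega> (x # xs)
    = - (\<Sum>j<length xs. (-1) ^ j * \<omega> (br x (xs ! j) # nths xs (- {j})))
      - ext_deriv br (interior x \<omega>) xs"
proof -
  have 1: "{k. k \<noteq> j} = - {j}" for j :: nat
    by auto
  have 2: "{k. k \<noteq> i \<and> k \<noteq> j} = - {i, j}" for i j :: nat
    by auto
  show ?thesis
    by (simp add: ext_deriv_def interior_def nths_Cons sum.lessThan_Suc_shift sum.distrib sum_negf
        1 2 forms_swap[OF assms, of _ x] sum_subtractf del: sum.lessThan_Suc)
qed

section \<open>Traces and the reflection\<close>

lemma sum_Basis_contract:
  fixes f :: "'a::euclidean_space \<Rightarrow> real"
  assumes "linear f"
  shows "(\<Sum>b\<in>Basis. (b \<bullet> v) * f b) = f v"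
proof -
  have "f v = f (\<Sum>b\<in>Basis. (v \<bullet> b) *\<^sub>R b)"
    by (simp add: euclidean_representation)
  also have "\<dots> = (\<Sum>b\<in>Basis. (v \<bullet> b) * f b)"
    by (simp add: linear_sum[OF assms] linear_cmul[OF assms])
  finally show ?thesis by (simp add: inner_commute)
qed

text \<open>Exchanging the two summation indices of \<open>\<Sum>\<langle>c, S b\<rangle> B(b, c)\<close> changes its sign.\<close>

lemma trace_symmetric_antisymmetric:
  fixes B :: "'a::euclidean_space \<Rightarrow> 'a \<Rightarrow> real"
  assumes lin: "\<And>v. linear (B v)" and anti: "\<And>v w. B v w = - B w v"
    and sym: "\<And>v w. S v \<bullet> w = v \<bullet> S w"
  shows "(\<Sum>b\<in>Basis. B b (S b)) = 0"
proof -
  have 1: "(\<Sum>b\<in>Basis. B b (S b)) = (\<Sum>b\<in>Basis. \<Sum>c\<in>Basis. (c \<bullet> S b) * B b c)"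
    by (simp add: sum_Basis_contract[OF lin])
  also have "\<dots> = (\<Sum>c\<in>Basis. \<Sum>b\<in>Basis. (c \<bullet> S b) * B b c)"
    by (rule sum.swap)
  also have "\<dots> = - (\<Sum>c\<in>Basis. \<Sum>b\<in>Basis. (b \<bullet> S c) * B c b)"
  proof -
    have "(c \<bullet> S b) * B b c = - ((b \<bullet> S c) * B c b)" for b c
      using anti[of b c] sym[of b c] by (simp add: inner_commute)
    then show ?thesis unfolding sum_negf[symmetric] by (intro sum.cong refl)
  qed
  finally show ?thesis using 1 by simp
qed

text \<open>For a unit vector \<open>e\<close> this is the orthogonal reflection in the hyperplane orthogonal to \<open>e\<close>.\<close>

definition mirror :: "'a::euclidean_space \<Rightarrow> 'a \<Rightarrow> 'a" where
  "mirror e x = x - (2 * (x \<bullet> e)) *\<^sub>R e"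

text \<open>Independence of the trace from the orthonormal basis, for the reflected basis: in the expansion the
  terms with \<open>f e e\<close> have coefficients \<open>-2 - 2 + 4 = 0\<close>.\<close>

lemma trace_mirror:
  fixes f :: "'a::euclidean_space \<Rightarrow> 'a \<Rightarrow> real"
  assumes r: "\<And>v. linear (f v)" and l: "\<And>w. linear (\<lambda>v. f v w)" and e: "norm e = 1"
  shows "(\<Sum>b\<in>Basis. f (mirror e b) (mirror e b)) = (\<Sum>b\<in>Basis. f b b)"
proof -
  have e1: "e \<bullet> e = 1" using e by (simp add: dot_square_norm)
  have "f (mirror e b) (mirror e b)
      = f b b - 2 * ((b \<bullet> e) * f b e) - 2 * ((b \<bullet> e) * f e b)
        + 4 * f e e * ((b \<bullet> e) * (b \<bullet> e))" for b
    by (simp add: mirror_def linear_diff[OF r] linear_cmul[OF r] linear_diff[OF l]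
        linear_cmul[OF l] algebra_simps)
  moreover have "(\<Sum>b\<in>Basis. (b \<bullet> e) * f b e) = f e e"
    by (rule sum_Basis_contract[OF l])
  moreover have "(\<Sum>b\<in>Basis. (b \<bullet> e) * f e b) = f e e"
    by (rule sum_Basis_contract[OF r])
  moreover have "(\<Sum>b\<in>Basis. (b \<bullet> e) * (b \<bullet> e)) = 1"
    using sum_Basis_contract[of "\<lambda>b. b \<bullet> e" e] e1 by (simp add: linear_iff inner_add_left)
  ultimately show ?thesis
    by (simp add: sum.distrib sum_subtractf flip: sum_distrib_left)
qed

lemma mirror_orthogonal:
  assumes "norm e = 1"
  shows "mirror e x \<bullet> mirror e y = x \<bullet> y"
proof -
  have "e \<bullet> e = 1" using assms by (simp add: dot_square_norm)
  then show ?thesis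
    by (simp add: mirror_def inner_diff_left inner_diff_right inner_commute)
qed

lemma mirror_mirror:
  assumes "norm e = 1"
  shows "mirror e (mirror e x) = x"
proof -
  have "e \<bullet> e = 1" using assms by (simp add: dot_square_norm)
  then show ?thesis by (simp add: mirror_def inner_diff_left algebra_simps flip: scaleR_add_left)
qed

lemma horizontal_mirror:
  assumes "\<gamma> \<in> horizontal_forms e0 k"
  shows "\<gamma> (map (mirror e0) xs) = \<gamma> xs"
  using assms
proof (induction xs arbitrary: \<gamma> k)
  case (Cons x xs)
  have f: "\<gamma> \<in> forms k" and z: "\<And>ys. \<gamma> (e0 # ys) = 0"
    using Cons.prems by (auto simp: horizontal_forms_def interior_def)
  have l: "linear (\<lambda>v. \<gamma> (v # ys))" for ys by (rule forms_Cons_linear[OF f])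
  have "\<gamma> (mirror e0 x # ys) = \<gamma> (x # ys)" for ys
    by (simp add: mirror_def linear_diff[OF l] linear_cmul[OF l] z)
  then show ?case
    using Cons.IH[OF interior_horizontal[OF Cons.prems, of x]] by (simp add: interior_def)
qed simp

lemma wedge1_mirror:
  assumes "norm e0 = 1" "\<alpha> \<in> horizontal_forms e0 k"
  shows "wedge1 (flat e0) \<alpha> (map (mirror e0) xs) = - wedge1 (flat e0) \<alpha> xs"
proof -
  have "e0 \<bullet> e0 = 1" using assms by (simp add: dot_square_norm)
  then have "flat e0 (mirror e0 x) = - flat e0 x" for x
    by (simp add: flat_def mirror_def inner_diff_right inner_commute)
  then show ?thesis
    by (simp add: wedge1_def nths_map horizontal_mirror[OF assms(2)] sum_negf)
qed

section \<open>The conformal Killing equation\<close>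

text \<open>The difference of the two sides of the conformal Killing equation, whose linearity in \<open>\<omega>\<close> and parity
  under the reflection are what the proof uses.\<close>

definition cky_defect ::
    "('a::euclidean_space \<Rightarrow> 'a \<Rightarrow> 'a) \<Rightarrow> nat \<Rightarrow> 'a form \<Rightarrow> 'a \<Rightarrow> 'a form" where
  "cky_defect br p \<omega> x = (\<lambda>xs. nabla br x \<omega> xs
     - 1 / (real p + 1) * interior x (ext_deriv br \<omega>) xs
     + 1 / (real DIM('a) - real p + 1) * wedge1 (flat x) (codiff br \<omega>) xs)"

lemma conformal_killing_iff_defect:
  "conformal_killing br p \<omega> \<longleftrightarrow> \<omega> \<in> forms p \<and> (\<forall>x xs. cky_defect br p \<omega> x xs = 0)"
  by (simp add: conformal_killing_def cky_defect_def algebra_simps)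

lemma nabla_eq_form_action: "nabla br x \<omega> = form_action (levi_civita br x) \<omega>"
  by (simp add: nabla_def form_action_def)

lemma cky_defect_combine:
  "cky_defect br p (\<lambda>ys. a * \<omega> ys + b * \<eta> ys) x xs
    = a * cky_defect br p \<omega> x xs + b * cky_defect br p \<eta> x xs"
proof -
  have d: "ext_deriv br (\<lambda>ys. a * \<omega> ys + b * \<eta> ys) zs
      = a * ext_deriv br \<omega> zs + b * ext_deriv br \<eta> zs" for zs
    by (simp add: ext_deriv_def sum.distrib sum_distrib_left algebra_simps)
  have c: "codiff br (\<lambda>ys. a * \<omega> ys + b * \<eta> ys)
      = (\<lambda>zs. a * codiff br \<omega> zs + b * codiff br \<eta> zs)"
    by (rule ext) (simp add: codiff_def interior_def nabla_eq_form_action form_action_combine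
        sum.distrib sum_distrib_left)
  show ?thesis
    unfolding cky_defect_def c wedge1_combine
    by (simp add: interior_def d nabla_eq_form_action form_action_combine algebra_simps)
qed

section \<open>Connection, differential and codifferential in the almost abelian case\<close>

text \<open>An almost abelian Lie algebra in terms of the unit normal \<open>e0\<close> of the ideal alone: the bracket is
  determined by the adjoint action of \<open>e0\<close> and takes values in the hyperplane orthogonal to \<open>e0\<close>.\<close>

locale almost_abelian =
  fixes br :: "'a::euclidean_space \<Rightarrow> 'a \<Rightarrow> 'a" and e0 :: 'a
  assumes bilinear: "bilinear br" and unit: "norm e0 = 1"
    and bracket: "br x y = (x \<bullet> e0) *\<^sub>R br e0 y - (y \<bullet> e0) *\<^sub>R br e0 x"
    and bracket_orthogonal: "br x y \<bullet> e0 = 0"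
begin

text \<open>The symmetric part of the adjoint action of \<open>e0\<close> is, up to sign, the shape operator of the ideal;
  the skew part is the covariant derivative along \<open>e0\<close>.\<close>

definition S :: "'a \<Rightarrow> 'a" where "S x = (1 / 2) *\<^sub>R (br e0 x + adjoint (br e0) x)"
definition A :: "'a \<Rightarrow> 'a" where "A x = (1 / 2) *\<^sub>R (br e0 x - adjoint (br e0) x)"

lemma linear_ad: "linear (br e0)"
  using bilinear by (simp add: bilinear_def)

lemma ad_e0: "br e0 e0 = 0"
  using bracket[of e0 e0] by simp

lemma adjoint_ad: "adjoint (br e0) x \<bullet> y = x \<bullet> br e0 y"
  using adjoint_works[OF linear_ad, of y x] by (simp add: inner_commute)

lemma adjoint_ad_e0: "adjoint (br e0) e0 = 0"
  using adjoint_ad[of e0 "adjoint (br e0) e0"] bracket_orthogonal[of e0]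
  by (simp add: inner_commute)

lemma linear_S: "linear S" and linear_A: "linear A"
  using linear_ad adjoint_linear[OF linear_ad]
  by (auto simp: S_def A_def linear_iff algebra_simps)

lemma S_e0: "S e0 = 0" and A_e0: "A e0 = 0"
  by (simp_all add: S_def A_def ad_e0 adjoint_ad_e0)

lemma S_symmetric: "S x \<bullet> y = x \<bullet> S y"
  by (simp add: S_def inner_add_left inner_add_right adjoint_ad inner_commute[of x "adjoint _ _"])
     (simp add: inner_commute)

text \<open>Insert the bracket into the Koszul formula, tested against \<open>z\<close>, and collect the coefficients of
  \<open>\<langle>x, e0\<rangle>\<close>, \<open>\<langle>y, e0\<rangle>\<close> and \<open>\<langle>z, e0\<rangle>\<close>.\<close>

lemma levi_civita_eq:
  "levi_civita br x y = (x \<bullet> e0) *\<^sub>R A y + (S x \<bullet> y) *\<^sub>R e0 - (y \<bullet> e0) *\<^sub>R S x"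
proof -
  have "2 * (levi_civita br x y \<bullet> z)
      = 2 * (((x \<bullet> e0) *\<^sub>R A y + (S x \<bullet> y) *\<^sub>R e0 - (y \<bullet> e0) *\<^sub>R S x) \<bullet> z)" for z
    unfolding levi_civita_koszul[OF bilinear] bracket[of x y] bracket[of y z] bracket[of z x]
    by (simp add: S_def A_def inner_add_left inner_diff_left adjoint_ad algebra_simps
        inner_commute[of e0] inner_commute[of _ "br e0 _"])
  then have "levi_civita br x y \<bullet> z
      = ((x \<bullet> e0) *\<^sub>R A y + (S x \<bullet> y) *\<^sub>R e0 - (y \<bullet> e0) *\<^sub>R S x) \<bullet> z" for z
    by simp
  then show ?thesis
    by (subst euclidean_eq_iff) blast
qed

lemma linear_levi_civita: "linear (levi_civita br x)" "linear (\<lambda>x. levi_civita br x y)"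
  unfolding levi_civita_eq
  by (auto simp: linear_iff linear_add[OF linear_A] linear_add[OF linear_S]
      linear_cmul[OF linear_A] linear_cmul[OF linear_S] inner_add_left inner_add_right algebra_simps)

text \<open>Every bracket of two arguments has a factor that pairs one of them with \<open>e0\<close>, so the exterior
  derivative is \<open>e\<^sup>0\<close> wedged with the action of \<open>e0\<close>. Cartan's formula and the antiderivation rule give
  both sides the same recursion.\<close>

lemma ext_deriv_eq_wedge1:
  assumes "\<omega> \<in> forms p"
  shows "ext_deriv br \<omega> xs = wedge1 (flat e0) (form_action (br e0) \<omega>) xs"
  using assms
proof (induction xs arbitrary: \<omega> p)
  case (Cons x xs)
  have l: "linear (\<lambda>v. \<omega> (v # ys))" for ys by (rule forms_Cons_linear[OF Cons.prems])
  have 1: "form_action (br e0) \<omega> xs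
      = - (\<Sum>j<length xs. (-1) ^ j * \<omega> (br e0 (xs ! j) # nths xs (- {j})))"
    by (simp add: form_action_def forms_move_to_front[OF Cons.prems])
  have 2: "- (\<Sum>j<length xs. (-1) ^ j * \<omega> (br x (xs ! j) # nths xs (- {j})))
      = flat e0 x * form_action (br e0) \<omega> xs + wedge1 (flat e0) (interior (br e0 x) \<omega>) xs"
    unfolding 1 bracket[of x "xs ! _"]
    by (simp add: linear_diff[OF l] linear_cmul[OF l] wedge1_def interior_def flat_def
        sum_subtractf sum_distrib_left inner_commute[of e0] algebra_simps)
  have 3: "interior x (form_action (br e0) \<omega>) = (\<lambda>ys. 1 * form_action (br e0) (interior x \<omega>) ys
      + (-1) * interior (br e0 x) \<omega> ys)"
    by (simp add: interior_def[of x "form_action _ _"] interior_def[of "br e0 x"] form_action_Cons)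
  show ?case
    unfolding ext_deriv_Cons[OF Cons.prems] 2 wedge1_Cons 3 wedge1_combine
      Cons.IH[OF interior_forms[OF Cons.prems]]
    by simp
qed (simp add: wedge1_Nil ext_deriv_Nil)

text \<open>The derivative is \<open>e\<^sup>0 \<and> e\<^sup>0 \<and> (D \<cdot> \<alpha>)\<close>, where \<open>D\<close> is the adjoint action of \<open>e0\<close>.\<close>

lemma ext_deriv_vertical:
  assumes "wedge1 (flat e0) \<alpha> \<in> forms p"
  shows "ext_deriv br (wedge1 (flat e0) \<alpha>) xs = 0"
proof -
  have "flat e0 (br e0 x) = 0" for x
    using bracket_orthogonal[of e0 x] by (simp add: flat_def inner_commute)
  then have "form_action (br e0) (wedge1 (flat e0) \<alpha>)
      = wedge1 (flat e0) (form_action (br e0) \<alpha>)"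
    by (intro ext form_action_wedge1)
  then show ?thesis
    by (simp add: ext_deriv_eq_wedge1[OF assms] wedge1_wedge1)
qed

text \<open>Coclosedness holds term by term in the argument on which the connection acts. The vector
  \<open>\<Sum>\<nabla>\<^sub>b b\<close> is a multiple of \<open>e0\<close>, which \<open>\<beta>\<close> annihilates. In the other terms \<open>\<beta>\<close> is an
  antisymmetric function of the basis vector and the argument acted upon, contracted with \<open>S\<close>.\<close>

lemma codiff_horizontal:
  assumes "\<beta> \<in> horizontal_forms e0 p"
  shows "codiff br \<beta> ys = 0"
proof -
  have f: "\<beta> \<in> forms p" and z: "\<And>ys. \<beta> (e0 # ys) = 0"
    using assms by (auto simp: horizontal_forms_def interior_def)
  have l: "linear (\<lambda>v. \<beta> (v # ys))" for ys by (rule forms_Cons_linear[OF f])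
  have first: "(\<Sum>b\<in>Basis. \<beta> (levi_civita br b b # ys)) = 0"
  proof -
    have l': "linear (\<lambda>v. \<beta> ((A v - S v) # ys))"
      using linear_compose[OF linear_compose_sub[OF linear_A linear_S] l] by (simp add: o_def)
    have "\<beta> (levi_civita br b b # ys) = (b \<bullet> e0) * \<beta> ((A b - S b) # ys)" for b
      unfolding levi_civita_eq
      by (simp add: linear_add[OF l] linear_diff[OF l] linear_cmul[OF l] z algebra_simps)
    then show ?thesis
      using sum_Basis_contract[OF l', of e0] z[of ys]
      by (simp add: A_e0 S_e0 linear_0[OF l])
  qed
  have rest: "(\<Sum>b\<in>Basis. \<beta> (b # ys[i := levi_civita br b (ys ! i)])) = 0"
    if i: "i < length ys" for i
  proof -
    \<comment> \<open>Moving \<open>w\<close> next to \<open>v\<close> shows that \<open>B\<close> is antisymmetric.\<close>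
    define B where "B v w = \<beta> (v # ys[i := w])" for v w
    have front: "B v w = (-1) ^ i * \<beta> (v # w # nths ys (- {i}))" for v w
      using forms_move_to_front[OF interior_forms[OF f, of v] i, of w]
      by (simp add: B_def interior_def)
    have anti: "B v w = - B w v" for v w
      by (simp add: front forms_swap[OF f, of v w])
    have lB: "linear (B v)" for v
      using forms_update_linear[OF interior_forms[OF f, of v] i] by (simp add: B_def[abs_def] interior_def)
    have lB': "linear (\<lambda>v. B v w)" for w
      using l by (simp add: B_def)
    have z1: "B e0 w = 0" for w by (simp add: B_def z)
    then have z2: "B w e0 = 0" for w using anti[of w e0] by simp
    have "(\<Sum>b\<in>Basis. B b (levi_civita br b (ys ! i)))
        = (\<Sum>b\<in>Basis. (b \<bullet> e0) * B b (A (ys ! i))) - (ys ! i \<bullet> e0) * (\<Sum>b\<in>Basis. B b (S b))"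
      unfolding levi_civita_eq
      by (simp add: linear_add[OF lB] linear_diff[OF lB] linear_cmul[OF lB] z2 sum_subtractf
          sum_distrib_left)
    then show ?thesis
      by (simp add: sum_Basis_contract[OF lB'] z1
          trace_symmetric_antisymmetric[OF lB anti S_symmetric] B_def[symmetric])
  qed
  have "codiff br \<beta> ys = (\<Sum>b\<in>Basis. \<beta> (levi_civita br b b # ys))
      + (\<Sum>b\<in>Basis. \<Sum>i<length ys. \<beta> (b # ys[i := levi_civita br b (ys ! i)]))"
    by (simp add: codiff_def interior_def nabla_def sum.lessThan_Suc_shift sum_negf sum_subtractf
        del: sum.lessThan_Suc)
  also have "\<dots> = 0"
    by (subst sum.swap) (simp add: first rest)
  finally show ?thesis .
qed

section \<open>Invariance of the equation under the reflection\<close>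

text \<open>A bracket lies in the mirror, so the reflection fixes it, while reflecting both arguments negates
  the coefficients \<open>\<langle>x, e0\<rangle>\<close> and \<open>\<langle>y, e0\<rangle>\<close> and leaves the adjoint action of \<open>e0\<close> unchanged.\<close>

lemma bracket_mirror: "br (mirror e0 x) (mirror e0 y) = - mirror e0 (br x y)"
proof -
  have e: "e0 \<bullet> e0 = 1" using unit by (simp add: dot_square_norm)
  have "br e0 (mirror e0 v) = br e0 v" for v
    by (simp add: mirror_def linear_diff[OF linear_ad] linear_cmul[OF linear_ad] ad_e0)
  moreover have "mirror e0 v \<bullet> e0 = - (v \<bullet> e0)" for v
    by (simp add: mirror_def inner_diff_left e)
  moreover have "mirror e0 (br x y) = br x y"
    by (simp add: mirror_def bracket_orthogonal)
  ultimately show ?thesis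
    using bracket[of "mirror e0 x" "mirror e0 y"] bracket[of x y] by simp
qed

text \<open>The Koszul formula is linear in the bracket, which changes sign, and the reflection is an isometry.\<close>

lemma levi_civita_mirror:
  "levi_civita br (mirror e0 x) (mirror e0 y) = - mirror e0 (levi_civita br x y)"
proof -
  note orth = mirror_orthogonal[OF unit]
  have "2 * (levi_civita br (mirror e0 x) (mirror e0 y) \<bullet> mirror e0 z)
      = - 2 * (mirror e0 (levi_civita br x y) \<bullet> mirror e0 z)" for z
    using levi_civita_koszul[OF bilinear, of x y z]
    by (simp add: levi_civita_koszul[OF bilinear] bracket_mirror orth)
  then have "levi_civita br (mirror e0 x) (mirror e0 y) \<bullet> z
      = (- mirror e0 (levi_civita br x y)) \<bullet> z" for z
    by (metis mirror_mirror[OF unit] inner_minus_left mult_minus_left mult_left_cancel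
        zero_neq_numeral mult_minus_right)
  then show ?thesis
    by (subst euclidean_eq_iff) blast
qed

lemma nabla_mirror:
  assumes "\<omega> \<in> forms p"
  shows "nabla br x (\<lambda>ys. \<omega> (map (mirror e0) ys)) xs
    = - nabla br (mirror e0 x) \<omega> (map (mirror e0) xs)"
proof -
  have "\<omega> ((map (mirror e0) xs)[i := - v]) = - \<omega> ((map (mirror e0) xs)[i := v])"
    if "i < length xs" for i v
    using linear_neg[OF forms_update_linear[OF assms, of i "map (mirror e0) xs"]] that by simp
  then show ?thesis
    by (simp add: nabla_def map_update levi_civita_mirror sum_negf)
qed

lemma ext_deriv_mirror:
  assumes "\<omega> \<in> forms p"
  shows "ext_deriv br (\<lambda>ys. \<omega> (map (mirror e0) ys)) xs
    = - ext_deriv br \<omega> (map (mirror e0) xs)"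
  by (simp add: ext_deriv_def bracket_mirror nths_map sum_negf
      linear_neg[OF forms_Cons_linear[OF assms]])

text \<open>The codifferential of the pulled back form is a trace over the reflected basis, which equals the
  trace over the original one.\<close>

lemma codiff_mirror:
  assumes "\<omega> \<in> forms p"
  shows "codiff br (\<lambda>ys. \<omega> (map (mirror e0) ys)) xs
    = - codiff br \<omega> (map (mirror e0) xs)"
proof -
  define zs where "zs = map (mirror e0) xs"
  define f where "f v w = nabla br v \<omega> (w # zs)" for v w
  have f: "f v w = - \<omega> (levi_civita br v w # zs)
      - (\<Sum>i<length zs. \<omega> (w # zs[i := levi_civita br v (zs ! i)]))" for v w
    by (simp add: f_def nabla_def sum.lessThan_Suc_shift del: sum.lessThan_Suc)
  have l: "linear (\<lambda>v. \<omega> (v # us))" for us by (rule forms_Cons_linear[OF assms])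
  have l': "linear (\<lambda>v. \<omega> (w # zs[i := v]))" if "i < length zs" for i w
    using forms_update_linear[OF interior_forms[OF assms, of w] that] by (simp add: interior_def)
  have "linear (f v)" for v
    unfolding f[abs_def]
    by (intro linear_compose_sub linear_compose_neg linear_compose_sum ballI l
        linear_compose[OF linear_levi_civita(1) l, unfolded o_def])
  moreover have "linear (\<lambda>v. f v w)" for w
    unfolding f[abs_def]
    by (intro linear_compose_sub linear_compose_neg linear_compose_sum ballI
        linear_compose[OF linear_levi_civita(2) l, unfolded o_def]
        linear_compose[OF linear_levi_civita(2) l', unfolded o_def]) simp
  ultimately have "(\<Sum>b\<in>Basis. f (mirror e0 b) (mirror e0 b)) = (\<Sum>b\<in>Basis. f b b)"
    by (rule trace_mirror[OF _ _ unit])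
  then show ?thesis
    by (simp add: codiff_def interior_def nabla_mirror[OF assms] sum_negf f_def zs_def)
qed

lemma cky_defect_mirror:
  assumes "\<omega> \<in> forms p"
  shows "cky_defect br p (\<lambda>ys. \<omega> (map (mirror e0) ys)) x xs
    = - cky_defect br p \<omega> (mirror e0 x) (map (mirror e0) xs)"
proof -
  have "wedge1 (flat x) (codiff br (\<lambda>ys. \<omega> (map (mirror e0) ys))) xs
      = - wedge1 (flat (mirror e0 x)) (codiff br \<omega>) (map (mirror e0) xs)"
    by (simp add: wedge1_def nths_map codiff_mirror[OF assms] flat_def sum_negf
        mirror_orthogonal[OF unit])
  then show ?thesis
    by (simp add: cky_defect_def interior_def nabla_mirror[OF assms] ext_deriv_mirror[OF assms])
qed

end

section \<open>Splitting conformal Killing forms\<close>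

text \<open>By its dimension the ideal is the whole hyperplane orthogonal to \<open>e0\<close>, so every vector splits into a
  multiple of \<open>e0\<close> and an element of the ideal.\<close>

lemma almost_abelian_of_ideal:
  fixes br :: "'a::euclidean_space \<Rightarrow> 'a \<Rightarrow> 'a"
  assumes "lie_bracket br" "codim_one_abelian_ideal br u" "norm e0 = 1"
    "\<forall>y\<in>u. e0 \<bullet> y = 0"
  shows "almost_abelian br e0"
proof -
  have bil: "bilinear br" and alt: "br x x = 0" for x
    using assms(1) by (auto simp: lie_bracket_def)
  have sub: "subspace u" and ideal: "\<And>x y. y \<in> u \<Longrightarrow> br x y \<in> u"
    and ab: "\<And>x y. x \<in> u \<Longrightarrow> y \<in> u \<Longrightarrow> br x y = 0" and dim: "dim u + 1 = DIM('a)"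
    using assms(2) by (auto simp: codim_one_abelian_ideal_def lie_ideal_def)
  have e: "e0 \<bullet> e0 = 1" using assms(3) by (simp add: dot_square_norm)
  then have "e0 \<noteq> 0" by auto
  then have "u = {x. e0 \<bullet> x = 0}"
    using sub assms(4) dim dim_hyperplane[of e0]
    by (intro subspace_dim_equal) (auto simp: subspace_hyperplane)
  then have "x - (x \<bullet> e0) *\<^sub>R e0 \<in> u" for x
    by (simp add: inner_diff_right e inner_commute)
  then obtain P where P: "\<And>x. P x \<in> u" "\<And>x. x = (x \<bullet> e0) *\<^sub>R e0 + P x"
    using that[of "\<lambda>x. x - (x \<bullet> e0) *\<^sub>R e0"] by simp
  have skew: "br x y = - br y x" for x y
  proof -
    have "br (x + y) (x + y) = br x x + br x y + (br y x + br y y)"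
      by (simp only: bilinear_ladd[OF bil] bilinear_radd[OF bil] ac_simps)
    then have "br x y + br y x = 0" by (simp only: alt) simp
    then show ?thesis by (simp only: eq_neg_iff_add_eq_0)
  qed
  have ad: "br e0 x = br e0 (P x)" for x
    by (subst P(2)[of x]) (simp add: bilinear_radd[OF bil] bilinear_rmul[OF bil] alt)
  have bracket: "br x y = (x \<bullet> e0) *\<^sub>R br e0 y - (y \<bullet> e0) *\<^sub>R br e0 x" for x y
  proof -
    have "br x y = br ((x \<bullet> e0) *\<^sub>R e0 + P x) ((y \<bullet> e0) *\<^sub>R e0 + P y)"
      by (simp flip: P(2))
    also have "\<dots> = (x \<bullet> e0) *\<^sub>R br e0 (P y) + (y \<bullet> e0) *\<^sub>R br (P x) e0"
      by (simp add: bilinear_ladd[OF bil] bilinear_radd[OF bil] bilinear_lmul[OF bil]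
          bilinear_rmul[OF bil] alt ab P(1))
    finally show ?thesis by (simp add: ad[of x] ad[of y] skew[of "P x"])
  qed
  have "br e0 x \<bullet> e0 = 0" for x
  proof -
    have "e0 \<bullet> br e0 (P x) = 0"
      using assms(4) ideal[OF P(1)] by blast
    then show ?thesis by (subst ad, subst inner_commute)
  qed
  then have "br x y \<bullet> e0 = 0" for x y
    by (subst bracket) (simp add: inner_diff_left)
  with bil bracket assms(3) show ?thesis by unfold_locales
qed

theorem theorem3p7:
  fixes br :: "'a::euclidean_space \<Rightarrow> 'a \<Rightarrow> 'a"
    and u :: "'a set" and e0 :: 'a and p :: nat
    and \<alpha> \<beta> \<omega> :: "'a form"
  assumes "lie_bracket br"
    and "codim_one_abelian_ideal br u"
    and "norm e0 = 1" and "\<forall>y\<in>u. e0 \<bullet> y = 0"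
    and "p \<ge> 1"
    and "\<alpha> \<in> horizontal_forms e0 (p - 1)"
    and "\<beta> \<in> horizontal_forms e0 p"
    and "\<omega> = (\<lambda>xs. wedge1 (flat e0) \<alpha> xs + \<beta> xs)"
  shows "conformal_killing br p \<omega> \<longleftrightarrow>
    star_killing br p (wedge1 (flat e0) \<alpha>) \<and> killing br p \<beta>"
proof -
  interpret almost_abelian br e0
    by (rule almost_abelian_of_ideal[OF assms(1-4)])
  define \<phi> where "\<phi> = wedge1 (flat e0) \<alpha>"
  have \<beta>: "\<beta> \<in> forms p" using assms(7) by (simp add: horizontal_forms_def)
  have star: "star_killing br p \<phi> \<longleftrightarrow> conformal_killing br p \<phi>"
    using ext_deriv_vertical by (auto simp: star_killing_def conformal_killing_def \<phi>_def)
  have "codiff br \<beta> = (\<lambda>ys. 0)"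
    using codiff_horizontal[OF assms(7)] by auto
  then have kill: "killing br p \<beta> \<longleftrightarrow> conformal_killing br p \<beta>"
    by (simp add: killing_def conformal_killing_def wedge1_zero)
  have \<omega>: "\<omega> = (\<lambda>xs. 1 * \<phi> xs + 1 * \<beta> xs)"
    using assms(8) by (simp add: \<phi>_def)
  have mirrored: "(\<lambda>ys. \<omega> (map (mirror e0) ys)) = (\<lambda>xs. (-1) * \<phi> xs + 1 * \<beta> xs)"
    by (simp add: \<omega> \<phi>_def wedge1_mirror[OF assms(3,6)] horizontal_mirror[OF assms(7)])
  have "conformal_killing br p \<omega> \<longleftrightarrow> conformal_killing br p \<phi> \<and> conformal_killing br p \<beta>"
  proof (intro iffI)
    assume ck: "conformal_killing br p \<omega>"
    then have f: "\<omega> \<in> forms p" and z: "\<And>x xs. cky_defect br p \<omega> x xs = 0"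
      by (auto simp: conformal_killing_iff_defect)
    \<comment> \<open>That \<open>\<phi>\<close> is a form follows here from its being the difference of two forms.\<close>
    have "\<phi> = (\<lambda>xs. 1 * \<omega> xs + (-1) * \<beta> xs)"
      by (simp add: \<omega>)
    then have \<phi>: "\<phi> \<in> forms p"
      using forms_combine[OF f \<beta>, of 1 "-1"] by simp
    have "cky_defect br p \<phi> x xs + cky_defect br p \<beta> x xs = 0" for x xs
      using z[of x xs] unfolding \<omega> cky_defect_combine by simp
    \<comment> \<open>The same equation for the mirrored form, in which \<open>\<phi>\<close> has the opposite sign.\<close>
    moreover have "- cky_defect br p \<phi> x xs + cky_defect br p \<beta> x xs = 0" for x xs
      using cky_defect_mirror[OF f, of x xs] unfolding mirrored cky_defect_combine z by simp
    ultimately have "cky_defect br p \<phi> x xs = 0" "cky_defect br p \<beta> x xs = 0" for x xs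
      by (smt (verit))+
    then show "conformal_killing br p \<phi> \<and> conformal_killing br p \<beta>"
      using \<phi> \<beta> by (simp add: conformal_killing_iff_defect)
  next
    assume "conformal_killing br p \<phi> \<and> conformal_killing br p \<beta>"
    then show "conformal_killing br p \<omega>"
      unfolding \<omega> conformal_killing_iff_defect cky_defect_combine
      using forms_combine[of \<phi> p \<beta> 1 1] by simp
  qed
  then show ?thesis
    by (simp add: star kill flip: \<phi>_def)
qed

end
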